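(* Let $T$ be a tournament with vertices $v_1,\dots,v_n$, $n>3$, and let $ET$ be the extended tournament obtained by blowing up $v_i$ into an independent set $I_i$ of size $s_i\ge1$, where at least one $s_i$ is even. Then $\chi'_{\mathrm{wo}}(ET)=3$ if $ET$ is bad, and $\chi'_{\mathrm{wo}}(ET)\le 2$ otherwise.
   Context: A tournament is an orientation of a complete graph. Given a tournament $T$ with vertices $v_1,\dots,v_n$ and integers $s_1,\dots,s_n\ge 1$, the extended tournament $ET$ has vertex set $I_1\cup\dots\cup I_n$ (disjoint sets, $|I_i|=s_i$, each $I_i$ independent), and for $x\in I_i$, $y\in I_j$ ($i\ne j$) there is an arc $xy$ iff $v_iv_j\in A(T)$. The extended tournament $ET$ with $n>3$ is called bad if all of the following hold: (a) $|V(ET)|=s_1+\dots+s_n$ is odd; (b) exactly one $s_j$ is even; (c) for this $j$, every vertex of $N_T^+(v_j)$ dominates (has an arc to) every vertex of $N_T^-(v_j)$; (d) $|N_T^-(v_j)|=1$ or $|N_T^+(v_j)|=1$. Here $N_T^+(v)$, $N_T^-(v)$ are the out- and in-neighbourhoods in $T$. For a vertex $v$ of a digraph $D$, the semi-cuts of $v$ are $\partial^+(v)$ (arcs leaving $v$) and $\partial^-(v)$ (arcs entering $v$). A map $\varphi:A(D)\to[k]=\{1,\dots,k\}$ satisfies condition (WO) at $v$ if there is a color $i\in[k]$ such that every nonempty semi-cut of $v$ contains an odd number of arcs of color $i$ (vacuous if both are empty). A weak-odd $k$-edge coloring is such a map satisfying (WO) at every vertex, and $\chi'_{\mathrm{wo}}(D)$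 is the least $k\ge0$ for which one exists. *)

theory Defs
  imports
    "Graph_Theory.Digraph"
    "HOL-Library.Disjoint_Sets"
    "HOL-Library.FuncSet"
    "HOL-Library.Extended_Nat"
begin

locale tournament = digraph T for T :: "('a, 'b) pre_digraph" +
  assumes exactly_one_arc:
    "\<lbrakk>u \<in> verts T; v \<in> verts T; u \<noteq> v\<rbrakk> \<Longrightarrow> (u \<rightarrow>\<^bsub>T\<^esub> v) \<longleftrightarrow> \<not> (v \<rightarrow>\<^bsub>T\<^esub> u)"

(* ET is obtained from T by blowing up each vertex v into the independent set I v of size s v. *)
locale extended_tournament = tournament T + ET: digraph ET
  for T :: "('a, 'b) pre_digraph" and s :: "'a \<Rightarrow> nat"
    and I :: "'a \<Rightarrow> 'c set" and ET :: "('c, 'd) pre_digraph" +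
  assumes size_pos: "v \<in> verts T \<Longrightarrow> s v \<ge> 1"
    and card_part: "v \<in> verts T \<Longrightarrow> card (I v) = s v"
    and disjoint_parts: "disjoint_family_on I (verts T)"
    and verts_ET: "verts ET = (\<Union>v\<in>verts T. I v)"
    and independent_part:
      "\<lbrakk>v \<in> verts T; x \<in> I v; y \<in> I v\<rbrakk> \<Longrightarrow> \<not> (x \<rightarrow>\<^bsub>ET\<^esub> y)"
    and arc_iff:
      "\<lbrakk>u \<in> verts T; v \<in> verts T; u \<noteq> v; x \<in> I u; y \<in> I v\<rbrakk>
        \<Longrightarrow> (x \<rightarrow>\<^bsub>ET\<^esub> y) \<longleftrightarrow> (u \<rightarrow>\<^bsub>T\<^esub> v)"

definition out_nbrs :: "('a, 'b) pre_digraph \<Rightarrow> 'a \<Rightarrow> 'a set" where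
  "out_nbrs G v = {w \<in> verts G. v \<rightarrow>\<^bsub>G\<^esub> w}"

definition in_nbrs :: "('a, 'b) pre_digraph \<Rightarrow> 'a \<Rightarrow> 'a set" where
  "in_nbrs G v = {w \<in> verts G. w \<rightarrow>\<^bsub>G\<^esub> v}"

definition bad_extension ::
  "('a, 'b) pre_digraph \<Rightarrow> ('a \<Rightarrow> nat) \<Rightarrow> ('c, 'd) pre_digraph \<Rightarrow> bool" where
  "bad_extension T s ET \<longleftrightarrow>
     card (verts T) > 3 \<and>
     odd (card (verts ET)) \<and>
     (\<exists>j. {v \<in> verts T. even (s v)} = {j} \<and>
        (\<forall>x\<in>out_nbrs T j. \<forall>y\<in>in_nbrs T j. x \<rightarrow>\<^bsub>T\<^esub> y) \<and>
        (card (in_nbrs T j) = 1 \<or> card (out_nbrs T j) = 1))"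

definition weak_odd_at ::
  "('a, 'b) pre_digraph \<Rightarrow> nat \<Rightarrow> ('b \<Rightarrow> nat) \<Rightarrow> 'a \<Rightarrow> bool" where
  "weak_odd_at D k \<phi> v \<longleftrightarrow>
     (out_arcs D v = {} \<and> in_arcs D v = {}) \<or>
     (\<exists>i\<in>{1..k}. \<forall>S\<in>{out_arcs D v, in_arcs D v}.
        S \<noteq> {} \<longrightarrow> odd (card {e \<in> S. \<phi> e = i}))"

definition weak_odd_edge_coloring ::
  "('a, 'b) pre_digraph \<Rightarrow> nat \<Rightarrow> ('b \<Rightarrow> nat) \<Rightarrow> bool" where
  "weak_odd_edge_coloring D k \<phi> \<longleftrightarrow>
     \<phi> \<in> arcs D \<rightarrow> {1..k} \<and> (\<forall>v\<in>verts D. weak_odd_at D k \<phi> v)"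

(* Taken in enat so that the value is infinity, rather than an arbitrary number,
   if no coloring exists; a nonempty set in enat contains its infimum. *)
definition weak_odd_chromatic_index :: "('a, 'b) pre_digraph \<Rightarrow> enat" where
  "weak_odd_chromatic_index D = Inf {enat k | k. \<exists>\<phi>. weak_odd_edge_coloring D k \<phi>}"

end

theory Submission
  imports Defs
begin

text \<open>Split every vertex \<open>v\<close> into an out-copy \<open>(v, True)\<close> and an in-copy \<open>(v, False)\<close>, so that arcs
  become edges of a bipartite graph, the bipartite double. Once each vertex has decided which of two
  colors witnesses its condition, the parities of color class 1 at all copies are prescribed, and
  such a color class exists iff every component of the bipartite double contains an even number of
  copies with odd prescription.

  For an extended tournament the non-isolated copies form a single component, and at most one vertex
  has to change its decision, unless some \<open>q \<rightarrow> p\<close> satisfies \<open>p \<rightarrow> v \<rightarrow> q\<close> for all other \<open>v\<close>. Then there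
  are two components, and badness says precisely that no decision makes the larger one even.
  Giving color 3 to one arc of the larger component that lies on a 4-cycle keeps the component
  connected and changes the parity of a degree, which repairs the count.\<close>

section \<open>Parity subgraphs of the bipartite double\<close>

definition incid :: "('a, 'b) pre_digraph \<Rightarrow> 'b set \<Rightarrow> 'a \<times> bool \<Rightarrow> 'b set" where
  "incid D F u = {e \<in> F. (if snd u then tail D e else head D e) = fst u}"

text \<open>Such an \<open>F\<close> is a T-join: a subgraph of the bipartite double whose
  odd-degree nodes are exactly those in \<open>X\<close>.\<close>

definition realizable :: "('a, 'b) pre_digraph \<Rightarrow> 'b set \<Rightarrow> ('a \<times> bool) set \<Rightarrow> bool" where
  "realizable D E X \<longleftrightarrow> (\<exists>F\<subseteq>E. \<forall>u. odd (card (incid D F u)) \<longleftrightarrow> u \<in> X)"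

text \<open>Connectivity without paths: by the handshake lemma, two distinct nodes of a finite graph
  admit a T-join exactly when they share a component. For \<open>u = w\<close> the symmetric
  difference is empty and so is the join.\<close>

definition linked :: "('a, 'b) pre_digraph \<Rightarrow> 'b set \<Rightarrow> 'a \<times> bool \<Rightarrow> 'a \<times> bool \<Rightarrow> bool" where
  "linked D E u w \<longleftrightarrow> realizable D E (sym_diff {u} {w})"

lemma even_card_sym_diff:
  assumes "finite A" "finite B"
  shows "even (card (sym_diff A B)) \<longleftrightarrow> even (card A + card B)"
proof -
  have "card (sym_diff A B) = card (A - B) + card (B - A)"
    using assms by (intro card_Un_disjoint) auto
  moreover have "card A = card (A - B) + card (A \<inter> B)"
    using assms by (metis card_Diff_subset_Int card_mono Int_lower1 finite_Int le_add_diff_inverse2)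
  moreover have "card B = card (B - A) + card (A \<inter> B)"
    using assms by (metis card_Diff_subset_Int card_mono Int_lower1 finite_Int le_add_diff_inverse2 Int_commute)
  ultimately show ?thesis by presburger
qed

lemma finite_incid [simp]: "finite F \<Longrightarrow> finite (incid D F u)"
  by (simp add: incid_def)

lemma incid_sym_diff: "incid D (sym_diff F G) u = sym_diff (incid D F u) (incid D G u)"
  by (auto simp: incid_def)

lemma realizable_empty: "realizable D E {}"
  unfolding realizable_def by (rule exI[of _ "{}"]) (simp add: incid_def)

text \<open>Degrees modulo 2 are additive under symmetric difference of edge sets.\<close>

lemma realizable_sym_diff:
  assumes "finite E" "realizable D E X" "realizable D E Y"
  shows "realizable D E (sym_diff X Y)"
proof -
  obtain F where F: "F \<subseteq> E" "\<And>u. odd (card (incid D F u)) \<longleftrightarrow> u \<in> X"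
    using assms(2) unfolding realizable_def by blast
  obtain G where G: "G \<subseteq> E" "\<And>u. odd (card (incid D G u)) \<longleftrightarrow> u \<in> Y"
    using assms(3) unfolding realizable_def by blast
  have fin: "finite F" "finite G" using F(1) G(1) assms(1) finite_subset by auto
  have "odd (card (incid D (sym_diff F G) u)) \<longleftrightarrow> u \<in> sym_diff X Y" for u
    unfolding incid_sym_diff even_card_sym_diff[OF finite_incid[OF fin(1)] finite_incid[OF fin(2)]]
    using F(2)[of u] G(2)[of u] by auto
  moreover have "sym_diff F G \<subseteq> E" using F(1) G(1) by auto
  ultimately show ?thesis unfolding realizable_def by blast
qed

lemma linked_refl: "linked D E u u"
  by (simp add: linked_def realizable_empty)

lemma linked_sym: "linked D E u w \<Longrightarrow> linked D E w u"
  by (simp add: linked_def Un_commute)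

lemma linked_trans:
  assumes "finite E" "linked D E u v" "linked D E v w"
  shows "linked D E u w"
proof -
  have "sym_diff {u} {w} = sym_diff (sym_diff {u} {v}) (sym_diff {v} {w})" by auto
  then show ?thesis
    using realizable_sym_diff[OF assms(1)] assms(2,3) unfolding linked_def by metis
qed

lemma linked_arc:
  assumes "e \<in> E"
  shows "linked D E (tail D e, True) (head D e, False)"
proof -
  have "incid D {e} u = (if u = (tail D e, True) \<or> u = (head D e, False) then {e} else {})" for u
    by (cases u) (auto simp: incid_def)
  then show ?thesis unfolding linked_def realizable_def using assms
    by (intro exI[of _ "{e}"]) auto
qed

text \<open>Pair up the nodes of \<open>X\<close>: each round removes two of them and superposes a
  join between that pair.\<close>

lemma realizable_even_linked:
  assumes "finite E" "finite X" "even (card X)" "\<And>u w. u \<in> X \<Longrightarrow> w \<in> X \<Longrightarrow> linked D E u w"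
  shows "realizable D E X"
  using assms(2-4)
proof (induction "card X" arbitrary: X rule: less_induct)
  case less
  show ?case
  proof (cases "X = {}")
    case True
    then show ?thesis by (simp add: realizable_empty)
  next
    case False
    then obtain u where u: "u \<in> X" by auto
    have "card X \<noteq> 1" using less.prems by auto
    then have "X \<noteq> {u}" by auto
    then obtain w where w: "w \<in> X" "w \<noteq> u" using u by auto
    have c: "card (X - {u, w}) = card X - 2" using u w less.prems(1) by (subst card_Diff_subset) auto
    have "card X - 2 < card X" using False less.prems by (simp add: card_gt_0_iff)
    then have "realizable D E (X - {u, w})"
      using less.prems c by (intro less.hyps) auto
    moreover have "realizable D E (sym_diff {u} {w})"
      using less.prems(3)[OF u w(1)] unfolding linked_def .
    ultimately have "realizable D E (sym_diff (X - {u, w}) (sym_diff {u} {w}))"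
      by (rule realizable_sym_diff[OF assms(1)])
    also have "sym_diff (X - {u, w}) (sym_diff {u} {w}) = X" using u w by auto
    finally show ?thesis .
  qed
qed

text \<open>In the bipartite double \<open>e\<close>, \<open>f\<close>, \<open>g\<close>,
  \<open>h\<close> form a closed walk of length 4, so the walk \<open>f\<close>, \<open>g\<close>,
  \<open>h\<close> replaces the deleted edge \<open>e\<close>; every other arc still links its own
  ends.\<close>

lemma linked_except_square_arc:
  assumes "finite (arcs D)" "E = arcs D - {e}"
    and "e \<in> arcs D" "f \<in> arcs D" "g \<in> arcs D" "h \<in> arcs D" "e \<noteq> f" "e \<noteq> g" "e \<noteq> h"
    and "tail D f = tail D e" "head D f = head D g" "tail D g = tail D h" "head D h = head D e"
    and "a \<in> arcs D"
  shows "linked D E (tail D a, True) (head D a, False)"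
proof (cases "a = e")
  case True
  have fin: "finite E" using assms by auto
  have "linked D E (tail D e, True) (head D g, False)"
    using linked_arc[of f E D] assms by auto
  moreover have "linked D E (head D g, False) (tail D h, True)"
    using linked_arc[of g E D] assms by (auto intro: linked_sym)
  moreover have "linked D E (tail D h, True) (head D e, False)"
    using linked_arc[of h E D] assms by auto
  ultimately show ?thesis using linked_trans[OF fin] True by metis
next
  case False
  then show ?thesis using assms by (auto intro!: linked_arc)
qed

section \<open>From parity subgraphs to weak-odd colorings\<close>

text \<open>Vertices in \<open>S\<close> witness the condition with color 2, all others with color 1.
  The color classes 1 and 2 share \<open>E\<close>; arcs outside \<open>E\<close> get color 3.\<close>

definition target :: "('a, 'b) pre_digraph \<Rightarrow> 'b set \<Rightarrow> 'a set \<Rightarrow> ('a \<times> bool) set" where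
  "target D E S = {u. incid D (arcs D) u \<noteq> {} \<and> (fst u \<in> S \<longrightarrow> even (card (incid D E u)))}"

lemma out_arcs_incid: "out_arcs D v = incid D (arcs D) (v, True)"
  by (auto simp: incid_def out_arcs_def)

lemma in_arcs_incid: "in_arcs D v = incid D (arcs D) (v, False)"
  by (auto simp: incid_def in_arcs_def)

text \<open>\<open>F\<close> gets color 1 and the rest of \<open>E\<close> color 2. At a copy over
  \<open>S\<close>, color 2 must have odd degree, so \<open>F\<close> has to be odd exactly where
  \<open>E\<close> is even; this is what \<open>target\<close> prescribes. Color 3 occurs only when
  \<open>E\<close> misses an arc. Copies without arcs are empty semi-cuts and impose
  nothing.\<close>

lemma weak_odd_edge_coloring_of_target:
  fixes D :: "('a, 'b) pre_digraph"
  assumes "finite (arcs D)" "E \<subseteq> arcs D" "2 \<le> k" "E = arcs D \<or> 3 \<le> k"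
    and "realizable D E (target D E S)"
  shows "\<exists>\<phi>. weak_odd_edge_coloring D k \<phi>"
proof -
  obtain F where F: "F \<subseteq> E" "\<And>u. odd (card (incid D F u)) \<longleftrightarrow> u \<in> target D E S"
    using assms(5) unfolding realizable_def by blast
  have fin: "finite E" "finite F" using F(1) assms(1,2) finite_subset by metis+
  define \<phi> :: "'b \<Rightarrow> nat" where "\<phi> e = (if e \<in> F then 1 else if e \<in> E then 2 else 3)" for e
  have 1: "{e \<in> incid D (arcs D) u. \<phi> e = 1} = incid D F u" for u
    using F(1) assms(2) by (auto simp: incid_def \<phi>_def)
  have 2: "{e \<in> incid D (arcs D) u. \<phi> e = 2} = incid D E u - incid D F u" for u
    using F(1) assms(2) by (auto simp: incid_def \<phi>_def)
  have "incid D F u \<subseteq> incid D E u" for u using F(1) by (auto simp: incid_def)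
  then have c2: "card {e \<in> incid D (arcs D) u. \<phi> e = 2} + card (incid D F u) = card (incid D E u)" for u
    unfolding 2 using fin by (metis card_Diff_subset card_mono finite_incid le_add_diff_inverse2)
  have key: "odd (card {e \<in> incid D (arcs D) (v, b). \<phi> e = (if v \<in> S then 2 else 1)})"
    if "incid D (arcs D) (v, b) \<noteq> {}" for v b
  proof (cases "v \<in> S")
    case True
    then show ?thesis using that F(2)[of "(v,b)"] c2[of "(v,b)"]
      by (auto simp: target_def) (metis even_add)+
  next
    case False
    then show ?thesis using that F(2)[of "(v,b)"] 1 by (auto simp: target_def)
  qed
  have "weak_odd_at D k \<phi> v" for v
    unfolding weak_odd_at_def out_arcs_incid in_arcs_incid
    using key[of v] assms(3) by (intro disjI2 bexI[of _ "if v \<in> S then 2 else 1"]) auto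
  moreover have "\<phi> \<in> arcs D \<rightarrow> {1..k}" using assms(3,4) by (auto simp: \<phi>_def)
  ultimately show ?thesis unfolding weak_odd_edge_coloring_def by blast
qed

text \<open>Within \<open>C\<close> the target differs from \<open>C\<close> at the nodes over
  \<open>S\<close> with odd \<open>E\<close>-degree, and their number has the parity of the degree
  sum.\<close>

lemma even_card_target:
  assumes "finite C" "\<And>u. u \<in> C \<Longrightarrow> incid D (arcs D) u \<noteq> {}"
  shows "even (card (target D E S \<inter> C)) \<longleftrightarrow>
    even (card C + (\<Sum>u | u \<in> C \<and> fst u \<in> S. card (incid D E u)))"
proof -
  let ?Y = "{u \<in> {u. u \<in> C \<and> fst u \<in> S}. odd (card (incid D E u))}"
  have "target D E S \<inter> C = sym_diff C ?Y"
    using assms(2) by (auto simp: target_def)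
  moreover have "even (\<Sum>u | u \<in> C \<and> fst u \<in> S. card (incid D E u)) \<longleftrightarrow> even (card ?Y)"
    using assms(1) by (intro even_sum_iff) auto
  ultimately show ?thesis
    using even_card_sym_diff[of C ?Y] assms(1) by auto
qed

section \<open>Components of the bipartite double of a tournament\<close>

text \<open>\<open>P\<close> and \<open>Q\<close> will be the traces of a component on out-copies
  and in-copies. Unless a cyclic pair exists, each value of \<open>P\<close> at a tail is shared by
  both copies of some vertex; two such vertices with opposite values would be joined by an arc that
  contradicts \<open>PQ\<close>.\<close>

lemma (in tournament) constant_or_cyclic_pair:
  assumes PQ: "\<And>u v. u \<rightarrow>\<^bsub>T\<^esub> v \<Longrightarrow> P u \<longleftrightarrow> Q v"
  shows "(\<exists>c. \<forall>u v. u \<rightarrow>\<^bsub>T\<^esub> v \<longrightarrow> P u = c) \<or>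
    (\<exists>p q. p \<in> verts T \<and> q \<in> verts T \<and> p \<noteq> q \<and> q \<rightarrow>\<^bsub>T\<^esub> p \<and>
       (\<forall>x\<in>verts T - {p, q}. p \<rightarrow>\<^bsub>T\<^esub> x \<and> x \<rightarrow>\<^bsub>T\<^esub> q))"
proof (rule disjCI)
  assume no: "\<not> (\<exists>p q. p \<in> verts T \<and> q \<in> verts T \<and> p \<noteq> q \<and> q \<rightarrow>\<^bsub>T\<^esub> p \<and>
       (\<forall>x\<in>verts T - {p, q}. p \<rightarrow>\<^bsub>T\<^esub> x \<and> x \<rightarrow>\<^bsub>T\<^esub> q))"
  \<comment> \<open>If there is no such \<open>x\<close>, then \<open>P p\<close> and
    \<open>Q q\<close> differ from \<open>c\<close>. For a third vertex \<open>x\<close>, an arc to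
    \<open>p\<close> forces \<open>P x = c\<close> and an arc from \<open>q\<close> forces
    \<open>Q x = c\<close>; both together are excluded, and one alone contradicts \<open>Q q\<close>
    or \<open>P p\<close>. So \<open>p\<close>, \<open>q\<close> form a cyclic pair.\<close>
  have pair: "\<exists>x\<in>verts T. P x = c \<and> Q x = c" if "q \<rightarrow>\<^bsub>T\<^esub> p" "P q = c" for c p q
  proof (rule ccontr)
    assume none: "\<not> (\<exists>x\<in>verts T. P x = c \<and> Q x = c)"
    have V: "p \<in> verts T" "q \<in> verts T" "p \<noteq> q"
      using that(1) adj_in_verts adj_not_same by auto
    have pq: "Q p = c" "P p \<noteq> c" "Q q \<noteq> c" using that none V PQ by blast+
    have "p \<rightarrow>\<^bsub>T\<^esub> x \<and> x \<rightarrow>\<^bsub>T\<^esub> q" if x: "x \<in> verts T - {p, q}" for x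
    proof -
      have xp: "p \<rightarrow>\<^bsub>T\<^esub> x \<or> x \<rightarrow>\<^bsub>T\<^esub> p" and xq: "q \<rightarrow>\<^bsub>T\<^esub> x \<or> x \<rightarrow>\<^bsub>T\<^esub> q"
        using exactly_one_arc x V by blast+
      have "P x \<noteq> c \<or> Q x \<noteq> c" using none x by auto
      then show ?thesis using xp xq PQ pq \<open>P q = c\<close> by metis
    qed
    then show False using no V that(1) by blast
  qed
  show "\<exists>c. \<forall>u v. u \<rightarrow>\<^bsub>T\<^esub> v \<longrightarrow> P u = c"
  proof (rule ccontr)
    assume "\<not> ?thesis"
    then obtain u v u' v' where "u \<rightarrow>\<^bsub>T\<^esub> v" "P u" "u' \<rightarrow>\<^bsub>T\<^esub> v'" "\<not> P u'" by metis
    then obtain w z where wz: "w \<in> verts T" "P w" "Q w" "z \<in> verts T" "\<not> P z" "\<not> Q z"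
      using pair[of u v True] pair[of u' v' False] by auto
    then have "w \<rightarrow>\<^bsub>T\<^esub> z \<or> z \<rightarrow>\<^bsub>T\<^esub> w" using exactly_one_arc by metis
    then show False using PQ wz by blast
  qed
qed

section \<open>Extended tournaments\<close>

lemma (in digraph) card_incid:
  "card (incid G (arcs G) (x, True)) = card {y. x \<rightarrow>\<^bsub>G\<^esub> y}"
  "card (incid G (arcs G) (x, False)) = card {y. y \<rightarrow>\<^bsub>G\<^esub> x}"
proof -
  have "inj_on (head G) (incid G (arcs G) (x, True))" "inj_on (tail G) (incid G (arcs G) (x, False))"
    using no_multi_arcs by (auto simp: inj_on_def incid_def arc_to_ends_def)
  moreover have "head G ` incid G (arcs G) (x, True) = {y. x \<rightarrow>\<^bsub>G\<^esub> y}"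
    "tail G ` incid G (arcs G) (x, False) = {y. y \<rightarrow>\<^bsub>G\<^esub> x}"
    by (auto simp: incid_def arcs_ends_def arc_to_ends_def image_iff)
  ultimately show "card (incid G (arcs G) (x, True)) = card {y. x \<rightarrow>\<^bsub>G\<^esub> y}"
    "card (incid G (arcs G) (x, False)) = card {y. y \<rightarrow>\<^bsub>G\<^esub> x}"
    by (metis card_image)+
qed

context extended_tournament
begin

lemma finite_part: "v \<in> verts T \<Longrightarrow> finite (I v)"
  using size_pos[of v] card_part[of v] card.infinite[of "I v"] by linarith

lemma part_nonempty: "v \<in> verts T \<Longrightarrow> \<exists>x. x \<in> I v"
  using size_pos[of v] card_part[of v] by (cases "I v = {}") auto

lemma part_subset: "v \<in> verts T \<Longrightarrow> x \<in> I v \<Longrightarrow> x \<in> verts ET"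
  by (auto simp: verts_ET)

lemma part_unique: "u \<in> verts T \<Longrightarrow> v \<in> verts T \<Longrightarrow> x \<in> I u \<Longrightarrow> x \<in> I v \<Longrightarrow> u = v"
  using disjoint_parts by (auto simp: disjoint_family_on_def)

lemma dominates_ET_iff:
  "x \<rightarrow>\<^bsub>ET\<^esub> y \<longleftrightarrow> (\<exists>u\<in>verts T. \<exists>v\<in>verts T. x \<in> I u \<and> y \<in> I v \<and> u \<rightarrow>\<^bsub>T\<^esub> v)"
proof
  assume xy: "x \<rightarrow>\<^bsub>ET\<^esub> y"
  then obtain u v where uv: "u \<in> verts T" "v \<in> verts T" "x \<in> I u" "y \<in> I v"
    using ET.adj_in_verts[OF xy] unfolding verts_ET by blast
  then have "u \<noteq> v" using independent_part xy by blast
  then show "\<exists>u\<in>verts T. \<exists>v\<in>verts T. x \<in> I u \<and> y \<in> I v \<and> u \<rightarrow>\<^bsub>T\<^esub> v"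
    using arc_iff uv xy by blast
next
  assume "\<exists>u\<in>verts T. \<exists>v\<in>verts T. x \<in> I u \<and> y \<in> I v \<and> u \<rightarrow>\<^bsub>T\<^esub> v"
  then show "x \<rightarrow>\<^bsub>ET\<^esub> y" using arc_iff adj_not_same by blast
qed

lemma card_UN_parts:
  assumes "W \<subseteq> verts T"
  shows "card (\<Union>v\<in>W. I v) = (\<Sum>v\<in>W. s v)"
proof -
  have "card (\<Union>v\<in>W. I v) = (\<Sum>v\<in>W. card (I v))"
    using assms finite_subset[OF assms finite_verts] finite_part part_unique
    by (intro card_UN_disjoint) blast+
  also have "\<dots> = (\<Sum>v\<in>W. s v)" using assms card_part by (intro sum.cong) auto
  finally show ?thesis .
qed

lemma card_verts_ET: "card (verts ET) = (\<Sum>v\<in>verts T. s v)"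
  unfolding verts_ET by (rule card_UN_parts) simp

lemma card_incid_part:
  assumes "u \<in> verts T" "x \<in> I u"
  shows "card (incid ET (arcs ET) (x, True)) = (\<Sum>v\<in>out_nbrs T u. s v)"
    and "card (incid ET (arcs ET) (x, False)) = (\<Sum>v\<in>in_nbrs T u. s v)"
proof -
  have "{y. x \<rightarrow>\<^bsub>ET\<^esub> y} = (\<Union>v\<in>out_nbrs T u. I v)" "{y. y \<rightarrow>\<^bsub>ET\<^esub> x} = (\<Union>v\<in>in_nbrs T u. I v)"
    using assms part_unique by (fastforce simp: dominates_ET_iff out_nbrs_def in_nbrs_def)+
  then show "card (incid ET (arcs ET) (x, True)) = (\<Sum>v\<in>out_nbrs T u. s v)"
    "card (incid ET (arcs ET) (x, False)) = (\<Sum>v\<in>in_nbrs T u. s v)"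
    using card_UN_parts[of "out_nbrs T u"] card_UN_parts[of "in_nbrs T u"]
    by (auto simp: ET.card_incid out_nbrs_def in_nbrs_def)
qed

text \<open>There is one arc between \<open>x\<close> and each vertex outside its part. The parity
  of this total tells whether a switch of the witness color at \<open>x\<close> changes the parity
  of a component containing both its copies.\<close>

lemma card_incid_total:
  assumes "u \<in> verts T" "x \<in> I u"
  shows "card (incid ET (arcs ET) (x, True)) + card (incid ET (arcs ET) (x, False)) + s u
    = card (verts ET)"
proof -
  have "verts T = insert u (out_nbrs T u \<union> in_nbrs T u)"
    using assms(1) exactly_one_arc by (auto simp: out_nbrs_def in_nbrs_def)
  moreover have "u \<notin> out_nbrs T u \<union> in_nbrs T u" "out_nbrs T u \<inter> in_nbrs T u = {}"
    using assms(1) exactly_one_arc adj_not_same by (auto simp: out_nbrs_def in_nbrs_def)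
  moreover have "finite (out_nbrs T u)" "finite (in_nbrs T u)"
    by (auto simp: out_nbrs_def in_nbrs_def)
  ultimately have "sum s (verts T) = s u + (sum s (out_nbrs T u) + sum s (in_nbrs T u))"
    by (metis finite_UnI sum.insert sum.union_disjoint)
  then show ?thesis using card_incid_part[OF assms] card_verts_ET by simp
qed

lemma linked_dominates:
  assumes "\<And>a. a \<in> arcs ET \<Longrightarrow> linked ET E (tail ET a, True) (head ET a, False)"
    and "x \<rightarrow>\<^bsub>ET\<^esub> y"
  shows "linked ET E (x, True) (y, False)"
  using assms by (auto simp: arcs_ends_def arc_to_ends_def)

lemma incid_nonempty_iff:
  "incid ET (arcs ET) (x, True) \<noteq> {} \<longleftrightarrow> (\<exists>y. x \<rightarrow>\<^bsub>ET\<^esub> y)"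
  "incid ET (arcs ET) (x, False) \<noteq> {} \<longleftrightarrow> (\<exists>y. y \<rightarrow>\<^bsub>ET\<^esub> x)"
  by (auto simp: incid_def arcs_ends_def arc_to_ends_def image_iff)

text \<open>Fix a non-isolated node \<open>n\<close> and apply
  \<open>constant_or_cyclic_pair\<close> to its component. Copies on one side of a part have the
  same neighbours, so the component can be described on \<open>T\<close>.\<close>

lemma linked_or_cyclic_pair:
  "(\<forall>u w. incid ET (arcs ET) u \<noteq> {} \<longrightarrow> incid ET (arcs ET) w \<noteq> {} \<longrightarrow> linked ET (arcs ET) u w) \<or>
    (\<exists>p q. p \<in> verts T \<and> q \<in> verts T \<and> p \<noteq> q \<and> q \<rightarrow>\<^bsub>T\<^esub> p \<and>
       (\<forall>x\<in>verts T - {p, q}. p \<rightarrow>\<^bsub>T\<^esub> x \<and> x \<rightarrow>\<^bsub>T\<^esub> q))"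
proof (rule disjCI)
  assume no: "\<not> (\<exists>p q. p \<in> verts T \<and> q \<in> verts T \<and> p \<noteq> q \<and> q \<rightarrow>\<^bsub>T\<^esub> p \<and>
       (\<forall>x\<in>verts T - {p, q}. p \<rightarrow>\<^bsub>T\<^esub> x \<and> x \<rightarrow>\<^bsub>T\<^esub> q))"
  let ?L = "linked ET (arcs ET)"
  note trans = linked_trans[OF ET.finite_arcs]
  have dom: "?L (x, True) (y, False)" if "x \<rightarrow>\<^bsub>ET\<^esub> y" for x y
    using linked_dominates[OF linked_arc that] .
  show "\<forall>u w. incid ET (arcs ET) u \<noteq> {} \<longrightarrow> incid ET (arcs ET) w \<noteq> {} \<longrightarrow> ?L u w"
  proof (intro allI impI)
    fix n w assume n: "incid ET (arcs ET) n \<noteq> {}" and w: "incid ET (arcs ET) w \<noteq> {}"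
    define P where "P v \<longleftrightarrow> (\<forall>x\<in>I v. ?L n (x, True))" for v
    define Q where "Q v \<longleftrightarrow> (\<forall>x\<in>I v. ?L n (x, False))" for v
    have step: "?L n (x, True) \<longleftrightarrow> ?L n (y, False)" if "x \<rightarrow>\<^bsub>ET\<^esub> y" for x y
      using dom[OF that] trans linked_sym by metis
    have PQ: "P u \<longleftrightarrow> Q v" if uv: "u \<rightarrow>\<^bsub>T\<^esub> v" for u v
    proof -
      have V: "u \<in> verts T" "v \<in> verts T" using uv adj_in_verts by auto
      obtain x y where xy: "x \<in> I u" "y \<in> I v" using part_nonempty V by metis
      have "?L n (x', True) \<longleftrightarrow> ?L n (y', False)" if "x' \<in> I u" "y' \<in> I v" for x' y'
        using step dominates_ET_iff that uv V by blast
      then show ?thesis unfolding P_def Q_def using xy by blast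
    qed
    obtain c where c: "\<And>u v. u \<rightarrow>\<^bsub>T\<^esub> v \<Longrightarrow> P u = c"
      using constant_or_cyclic_pair[of P Q, OF PQ] no by blast
    \<comment> \<open>Any in-copy over \<open>I v\<close> is a common neighbour of all out-copies
      over \<open>I u\<close>, so one linked copy brings in the whole part.\<close>
    have single: "P u" if "u \<rightarrow>\<^bsub>T\<^esub> v" "x \<in> I u" "?L n (x, True)" for u v x
    proof -
      have V: "u \<in> verts T" "v \<in> verts T" using that adj_in_verts by auto
      have "Q v" unfolding Q_def using that V step dominates_ET_iff by blast
      then show ?thesis using PQ that by blast
    qed
    have ends: "\<exists>u v x y. u \<rightarrow>\<^bsub>T\<^esub> v \<and> x \<in> I u \<and> y \<in> I v \<and> x \<rightarrow>\<^bsub>ET\<^esub> y \<and> (m = (x, True) \<or> m = (y, False))"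
      if "incid ET (arcs ET) m \<noteq> {}" for m
    proof -
      obtain x b where m: "m = (x, b)" by (cases m)
      have "\<exists>x' y. x' \<rightarrow>\<^bsub>ET\<^esub> y \<and> (m = (x', True) \<or> m = (y, False))"
        using that incid_nonempty_iff[of x] unfolding m by (cases b) auto
      then show ?thesis using dominates_ET_iff by metis
    qed
    obtain u v x y where uv: "u \<rightarrow>\<^bsub>T\<^esub> v" "x \<in> I u" "y \<in> I v" "x \<rightarrow>\<^bsub>ET\<^esub> y"
      "n = (x, True) \<or> n = (y, False)" using ends[OF n] by blast
    then have "?L n (x, True)" using linked_refl step by metis
    \<comment> \<open>The constant value is \<open>True\<close>, because the arc at \<open>n\<close>
      already yields a tail part linked to \<open>n\<close>.\<close>
    then have c: "P u'" if "u' \<rightarrow>\<^bsub>T\<^esub> v'" for u' v' using single uv c that by blast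
    obtain u v x y where "u \<rightarrow>\<^bsub>T\<^esub> v" "x \<in> I u" "y \<in> I v" "x \<rightarrow>\<^bsub>ET\<^esub> y"
      "w = (x, True) \<or> w = (y, False)" using ends[OF w] by blast
    then show "?L n w" using c PQ unfolding P_def Q_def by blast
  qed
qed

text \<open>With a single component only one parity matters. If the number of non-isolated copies is
  even, color 1 is the witness everywhere; if not, one vertex of odd total degree switches to color
  2.\<close>

lemma two_coloring_if_linked:
  assumes all: "\<And>u w. incid ET (arcs ET) u \<noteq> {} \<Longrightarrow> incid ET (arcs ET) w \<noteq> {} \<Longrightarrow>
      linked ET (arcs ET) u w"
    and even_part: "\<exists>v\<in>verts T. even (s v)"
  shows "\<exists>\<phi>. weak_odd_edge_coloring ET 2 \<phi>"
proof -
  let ?C = "{u. incid ET (arcs ET) u \<noteq> {}}"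
  let ?O = "\<Union>v\<in>{v\<in>verts T. out_nbrs T v \<noteq> {}}. I v" and ?N = "\<Union>v\<in>{v\<in>verts T. in_nbrs T v \<noteq> {}}. I v"
  have out: "(\<exists>y. x \<rightarrow>\<^bsub>ET\<^esub> y) \<longleftrightarrow> x \<in> ?O" for x
    using part_nonempty by (fastforce simp: dominates_ET_iff out_nbrs_def)
  have inn: "(\<exists>y. y \<rightarrow>\<^bsub>ET\<^esub> x) \<longleftrightarrow> x \<in> ?N" for x
    using part_nonempty by (fastforce simp: dominates_ET_iff in_nbrs_def)
  have C: "?C = ?O \<times> {True} \<union> ?N \<times> {False}"
  proof (rule set_eqI)
    fix u :: "'c \<times> bool"
    obtain x b where u: "u = (x, b)" by (cases u)
    show "u \<in> ?C \<longleftrightarrow> u \<in> ?O \<times> {True} \<union> ?N \<times> {False}"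
      unfolding u using incid_nonempty_iff[of x] out[of x] inn[of x] by (cases b) auto
  qed
  have finC: "finite ?C" unfolding C using finite_part by auto
  have suff: ?thesis
    if "even (card ?C + (\<Sum>u | u \<in> ?C \<and> fst u \<in> S. card (incid ET (arcs ET) u)))" for S
  proof (rule weak_odd_edge_coloring_of_target)
    have "even (card (target ET (arcs ET) S \<inter> ?C))"
      using that even_card_target[OF finC] by auto
    moreover have "target ET (arcs ET) S \<inter> ?C = target ET (arcs ET) S" by (auto simp: target_def)
    ultimately have "even (card (target ET (arcs ET) S))" by simp
    moreover have "finite (target ET (arcs ET) S)"
      by (rule finite_subset[OF _ finC]) (auto simp: target_def)
    ultimately show "realizable ET (arcs ET) (target ET (arcs ET) S)"
      using all by (intro realizable_even_linked) (auto simp: target_def)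
  qed auto
  show ?thesis
  proof (cases "even (card ?C)")
    case True
    then show ?thesis using suff[of "{}"] by simp
  next
    case False
    have "card ?C = card ?O + card ?N"
      unfolding C using finite_part by (subst card_Un_disjoint) (auto simp: card_cartesian_product)
    also have "\<dots> = sum s {v\<in>verts T. out_nbrs T v \<noteq> {}} + sum s {v\<in>verts T. in_nbrs T v \<noteq> {}}"
      by (subst (1 2) card_UN_parts) auto
    \<comment> \<open>The odd count rules out that all part sizes are even. So both parities occur
      among them, and one is opposite to that of \<open>card (verts ET)\<close>.\<close>
    finally have "\<not> (\<forall>v\<in>verts T. even (s v))" using False
      by (metis (mono_tags, lifting) dvd_add dvd_sum mem_Collect_eq)
    with even_part obtain v where v: "v \<in> verts T" "odd (card (verts ET) + s v)"
      by (metis even_add)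
    obtain x where x: "x \<in> I v" using part_nonempty v by blast
    let ?d = "\<lambda>b. card (incid ET (arcs ET) (x, b))"
    have odd: "odd (?d True + ?d False)" using card_incid_total[OF v(1) x] v(2) by presburger
    have "(\<Sum>u | u \<in> ?C \<and> fst u \<in> {x}. card (incid ET (arcs ET) u))
        = (\<Sum>u\<in>{(x, True), (x, False)}. card (incid ET (arcs ET) u))"
    proof (rule sum.mono_neutral_left)
      show "{u. u \<in> ?C \<and> fst u \<in> {x}} \<subseteq> {(x, True), (x, False)}" by auto
    qed auto
    then show ?thesis using suff[of "{x}"] False odd by auto
  qed
qed

end

section \<open>The disconnected case\<close>

text \<open>The bipartite double has exactly two components here: one carries the arcs from \<open>I q\<close> to
  \<open>I p\<close>, the other one all remaining arcs.\<close>

locale cyclic_extension = extended_tournament T s I ET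
  for T :: "('a, 'b) pre_digraph" and s :: "'a \<Rightarrow> nat"
    and I :: "'a \<Rightarrow> 'c set" and ET :: "('c, 'd) pre_digraph" +
  fixes p q :: 'a
  assumes p_in: "p \<in> verts T" and q_in: "q \<in> verts T" and p_neq_q: "p \<noteq> q"
    and qp: "q \<rightarrow>\<^bsub>T\<^esub> p"
    and rest: "v \<in> verts T - {p, q} \<Longrightarrow> p \<rightarrow>\<^bsub>T\<^esub> v \<and> v \<rightarrow>\<^bsub>T\<^esub> q"
    and card_gt_3: "card (verts T) > 3"
begin

abbreviation A where "A \<equiv> arcs ET"
abbreviation R where "R \<equiv> verts T - {p, q}"

definition minor where "minor = I q \<times> {True} \<union> I p \<times> {False}"
definition major where "major = (verts ET - I q) \<times> {True} \<union> (verts ET - I p) \<times> {False}"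

lemma card_R: "card R \<ge> 2"
  using card_gt_3 p_in q_in p_neq_q by (subst card_Diff_subset) auto

lemma two_in_R: obtains v w where "v \<in> R" "w \<in> R" "v \<noteq> w" "v \<rightarrow>\<^bsub>T\<^esub> w"
proof -
  obtain v w where vw: "v \<in> R" "w \<in> R" "v \<noteq> w"
    using card_R card_2_iff' obtain_subset_with_card_n[of 2 R] by (metis subset_iff)
  then show ?thesis using exactly_one_arc[of v w] that[of v w] that[of w v] by blast
qed

lemma nbrs:
  "out_nbrs T p = R" "in_nbrs T p = {q}" "out_nbrs T q = {p}" "in_nbrs T q = R"
proof -
  have 1: "\<not> p \<rightarrow>\<^bsub>T\<^esub> q" using exactly_one_arc qp p_in q_in p_neq_q by blast
  have 2: "\<not> p \<rightarrow>\<^bsub>T\<^esub> p" "\<not> q \<rightarrow>\<^bsub>T\<^esub> q" using adj_not_same by blast+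
  have 3: "\<not> v \<rightarrow>\<^bsub>T\<^esub> p" "\<not> q \<rightarrow>\<^bsub>T\<^esub> v" if "v \<in> R" for v
    using exactly_one_arc[of v p] exactly_one_arc[of q v] that rest[OF that] p_in q_in by blast+
  show "out_nbrs T p = R" "in_nbrs T p = {q}" "out_nbrs T q = {p}" "in_nbrs T q = R"
    unfolding out_nbrs_def in_nbrs_def using 1 2 3 rest qp p_in q_in by blast+
qed

lemma card_incid_p:
  "x \<in> I p \<Longrightarrow> card (incid ET A (x, True)) = sum s R"
  "x \<in> I p \<Longrightarrow> card (incid ET A (x, False)) = s q"
  using card_incid_part[OF p_in] by (auto simp: nbrs)

lemma card_incid_q:
  "x \<in> I q \<Longrightarrow> card (incid ET A (x, True)) = s p"
  "x \<in> I q \<Longrightarrow> card (incid ET A (x, False)) = sum s R"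
  using card_incid_part[OF q_in] by (auto simp: nbrs)

lemma card_verts_split: "card (verts ET) = s p + s q + sum s R"
proof -
  have "sum s (verts T) = sum s {p, q} + sum s R"
    using sum.subset_diff[of "{p, q}" "verts T" s] p_in q_in by simp
  then show ?thesis using p_neq_q by (simp add: card_verts_ET)
qed

text \<open>Every vertex of \<open>T\<close> lies on a cyclic triangle
  \<open>p \<rightarrow> w \<rightarrow> q \<rightarrow> p\<close> with \<open>w\<close> in
  \<open>R\<close>.\<close>

lemma incid_nonempty:
  assumes "x \<in> verts ET"
  shows "incid ET A (x, b) \<noteq> {}"
proof -
  obtain v where v: "v \<in> verts T" "x \<in> I v" using assms verts_ET by auto
  obtain w where w: "w \<in> R" using two_in_R by blast
  have "\<exists>u\<in>verts T. v \<rightarrow>\<^bsub>T\<^esub> u" "\<exists>u\<in>verts T. u \<rightarrow>\<^bsub>T\<^esub> v"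
    using v(1) w rest qp p_in q_in by (cases "v = p"; cases "v = q"; blast)+
  then have "\<exists>y. x \<rightarrow>\<^bsub>ET\<^esub> y" "\<exists>y. y \<rightarrow>\<^bsub>ET\<^esub> x"
    unfolding dominates_ET_iff using v part_nonempty by blast+
  then show ?thesis using incid_nonempty_iff[of x] by (cases b) auto
qed

lemma parts_disjoint: "I p \<inter> I q = {}" "v \<in> R \<Longrightarrow> I v \<inter> I p = {}" "v \<in> R \<Longrightarrow> I v \<inter> I q = {}"
  using part_unique p_in q_in p_neq_q by blast+

lemma finite_nodes: "finite minor" "finite major"
  using finite_part p_in q_in by (auto simp: minor_def major_def)

text \<open>\<open>major\<close> has \<open>s p + s q + 2 * sum s R\<close> nodes, so the two
  components have equal size modulo 2.\<close>

lemma card_nodes: "card minor = s p + s q" "even (card major) \<longleftrightarrow> even (s p + s q)"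
proof -
  have "card minor = card (I q) + card (I p)"
    unfolding minor_def using finite_part p_in q_in
    by (subst card_Un_disjoint) (auto simp: card_cartesian_product)
  then show "card minor = s p + s q" using card_part p_in q_in by simp
  have sub: "I p \<subseteq> verts ET" "I q \<subseteq> verts ET" using part_subset p_in q_in by blast+
  have "card major = card (verts ET - I q) + card (verts ET - I p)"
    unfolding major_def by (subst card_Un_disjoint) (auto simp: card_cartesian_product)
  also have "\<dots> = (s p + sum s R) + (s q + sum s R)"
    using sub finite_part p_in q_in card_part card_verts_split by (simp add: card_Diff_subset)
  finally show "even (card major) \<longleftrightarrow> even (s p + s q)" by presburger
qed

text \<open>In \<open>major\<close>, out-copies of \<open>p\<close> meet in-copies of
  \<open>R\<close>, and out-copies of \<open>R\<close> meet in-copies of \<open>q\<close>; an arc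
  inside \<open>R\<close>, available because \<open>n > 3\<close>, bridges these halves. Only the
  ends of arcs are assumed to be linked, so that \<open>E\<close> may miss an arc.\<close>

lemma linked_nodes:
  assumes fin: "finite E" and lk: "\<And>a. a \<in> A \<Longrightarrow> linked ET E (tail ET a, True) (head ET a, False)"
  shows "u \<in> minor \<Longrightarrow> w \<in> minor \<Longrightarrow> linked ET E u w"
    and "u \<in> major \<Longrightarrow> w \<in> major \<Longrightarrow> linked ET E u w"
proof -
  let ?L = "linked ET E"
  note trans = linked_trans[OF fin]
  have dom: "?L (x, True) (y, False)" "?L (y, False) (x, True)"
    if "g \<rightarrow>\<^bsub>T\<^esub> h" "x \<in> I g" "y \<in> I h" for g h x y
    using that linked_dominates[of E x y, OF lk] dominates_ET_iff adj_in_verts linked_sym by blast+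
  obtain v v' where vw: "v \<in> R" "v' \<in> R" "v \<rightarrow>\<^bsub>T\<^esub> v'" using two_in_R by blast
  obtain y z a b where yz: "y \<in> I v" "z \<in> I v'" "a \<in> I p" "b \<in> I q"
    using part_nonempty vw p_in q_in by (metis DiffD1)
  have minor: "?L u (b, True)" if "u \<in> minor" for u
    using that dom[OF qp] yz trans linked_refl unfolding minor_def by blast
  show "u \<in> minor \<Longrightarrow> w \<in> minor \<Longrightarrow> ?L u w"
    using minor trans linked_sym by blast
  have pz: "?L (x, True) (y, True)" if "x \<in> I p" for x
    using dom[of p v' x z] dom[OF vw(3) yz(1,2)] rest[OF vw(2)] that yz trans by blast
  have qy: "?L (x, False) (y, True)" if "x \<in> I q" for x
    using dom[of v q y x] rest[OF vw(1)] that yz by blast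
  have major: "?L u (y, True)" if u: "u \<in> major" for u
  proof -
    obtain x c where x: "u = (x, c)" by (cases u)
    obtain g where g: "g \<in> verts T" "x \<in> I g" using u verts_ET by (auto simp: major_def x)
    show ?thesis
    proof (cases c)
      case True
      then have "g \<noteq> q" using u g by (auto simp: x major_def)
      then consider "g = p" | "g \<rightarrow>\<^bsub>T\<^esub> q" using rest[of g] g by blast
      then have "?L (x, True) (y, True)"
      proof cases
        case 2
        then show ?thesis using trans[OF dom(1) qy] g yz by blast
      qed (use pz g in auto)
      then show ?thesis using True x by simp
    next
      case False
      then have "g \<noteq> p" using u g by (auto simp: x major_def)
      then consider "g = q" | "p \<rightarrow>\<^bsub>T\<^esub> g" using rest[of g] g by blast
      then have "?L (x, False) (y, True)"
      proof cases
        case 2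
        then show ?thesis using trans[OF dom(2) pz] g yz by blast
      qed (use qy g in auto)
      then show ?thesis using False x by simp
    qed
  qed
  show "u \<in> major \<Longrightarrow> w \<in> major \<Longrightarrow> ?L u w"
    using major trans linked_sym by blast
qed

text \<open>By \<open>even_card_target\<close> and the common parity of the component sizes, the
  last two hypotheses make the target even on each component; the two joins are then
  superposed.\<close>

lemma coloring_of_parities:
  assumes E: "E \<subseteq> A" and k: "2 \<le> k" "E = A \<or> 3 \<le> k"
    and lk: "\<And>a. a \<in> A \<Longrightarrow> linked ET E (tail ET a, True) (head ET a, False)"
    and minor: "even (s p + s q + (\<Sum>u | u \<in> minor \<and> fst u \<in> S. card (incid ET E u)))"
    and major: "even (s p + s q + (\<Sum>u | u \<in> major \<and> fst u \<in> S. card (incid ET E u)))"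
  shows "\<exists>\<phi>. weak_odd_edge_coloring ET k \<phi>"
proof (rule weak_odd_edge_coloring_of_target[OF ET.finite_arcs E k])
  let ?X = "target ET E S"
  have finE: "finite E" using E ET.finite_arcs finite_subset by blast
  have inv: "incid ET A u \<noteq> {}" if "u \<in> minor \<union> major" for u
    using that incid_nonempty part_subset p_in q_in by (auto simp: minor_def major_def)
  have "even (card (?X \<inter> minor))"
    using even_card_target[of minor ET E S] finite_nodes inv minor card_nodes by simp
  then have 1: "realizable ET E (?X \<inter> minor)"
    using finite_nodes linked_nodes(1)[OF finE lk] by (intro realizable_even_linked[OF finE]) auto
  have "even (card (?X \<inter> major))"
    using even_card_target[of major ET E S] finite_nodes inv major card_nodes by simp
  then have 2: "realizable ET E (?X \<inter> major)"
    using finite_nodes linked_nodes(2)[OF finE lk] by (intro realizable_even_linked[OF finE]) auto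
  have "u \<in> minor \<union> major" if u: "incid ET A u \<noteq> {}" for u
  proof -
    obtain x b where x: "u = (x, b)" by (cases u)
    have "x \<in> verts ET" using u by (auto simp: x incid_def split: if_splits)
    then show ?thesis by (auto simp: x minor_def major_def)
  qed
  moreover have "minor \<inter> major = {}" by (auto simp: minor_def major_def)
  ultimately have "?X = sym_diff (?X \<inter> minor) (?X \<inter> major)"
    by (auto simp: target_def)
  then show "realizable ET E ?X" using realizable_sym_diff[OF finE 1 2] by simp
qed

lemmas two_coloring_of_parities =
  coloring_of_parities[of A 2, OF subset_refl order_refl disjI1[OF refl] linked_arc]

text \<open>The vertex \<open>x\<close> comes from whichever of \<open>I p\<close>,
  \<open>I q\<close> has even size. The degree of its \<open>minor\<close> copy is the size of the
  other part, hence odd. Even size also provides a second vertex \<open>x'\<close> in the same part;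
  with \<open>y\<close>, \<open>z\<close> from two parts of \<open>R\<close> this gives the square
  through \<open>e\<close>.\<close>

lemma pivot:
  assumes odd: "odd (s p + s q)"
  obtains x b e where "{u. u \<in> minor \<and> fst u = x} = {(x, b)}" "{u. u \<in> major \<and> fst u = x} = {(x, \<not> b)}"
    and "x \<in> I p \<union> I q" "odd (card (incid ET A (x, b)))" "card (incid ET A (x, \<not> b)) = sum s R"
    and "e \<in> incid ET A (x, \<not> b)" "e \<notin> incid ET A (x, b)"
    and "\<And>a. a \<in> A \<Longrightarrow> linked ET (A - {e}) (tail ET a, True) (head ET a, False)"
proof -
  obtain v w where vw: "v \<in> R" "w \<in> R" "v \<noteq> w" using two_in_R by blast
  obtain y z where yz: "y \<in> I v" "z \<in> I w" using part_nonempty vw by (metis DiffD1)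
  have "y \<noteq> z" using yz vw part_unique by blast
  have arc: "\<exists>e\<in>A. tail ET e = x \<and> head ET e = y" if "g \<rightarrow>\<^bsub>T\<^esub> h" "x \<in> I g" "y \<in> I h" for g h x y
  proof -
    have "x \<rightarrow>\<^bsub>ET\<^esub> y" using dominates_ET_iff that adj_in_verts by blast
    then show ?thesis by (auto simp: arcs_ends_def arc_to_ends_def)
  qed
  have two: "\<exists>x x'. x \<in> I j \<and> x' \<in> I j \<and> x \<noteq> x'" if "j \<in> verts T" "even (s j)" for j
  proof -
    have "2 \<le> card (I j)" using size_pos[of j] card_part[of j] that by (auto elim!: evenE)
    then obtain Y where "Y \<subseteq> I j" "card Y = 2" using obtain_subset_with_card_n by metis
    then show ?thesis by (auto simp: card_2_iff)
  qed
  have sub: "I p \<subseteq> verts ET" "I q \<subseteq> verts ET" using part_subset p_in q_in by blast+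
  show thesis
  proof (cases "even (s p)")
    case True
    then have q: "odd (s q)" using odd by simp
    obtain x x' where x: "x \<in> I p" "x' \<in> I p" "x \<noteq> x'" using two True p_in by blast
    obtain e where e: "e \<in> A" "tail ET e = x" "head ET e = y" using arc rest vw x yz by metis
    obtain f where f: "f \<in> A" "tail ET f = x" "head ET f = z" using arc rest vw x yz by metis
    obtain g where g: "g \<in> A" "tail ET g = x'" "head ET g = z" using arc rest vw x yz by metis
    obtain h where h: "h \<in> A" "tail ET h = x'" "head ET h = y" using arc rest vw x yz by metis
    have "x \<noteq> y" using x yz vw parts_disjoint by blast
    show thesis
    proof (rule that[of x False e])
      show "linked ET (A - {e}) (tail ET a, True) (head ET a, False)" if "a \<in> A" for a
        using that e f g h x \<open>y \<noteq> z\<close>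
        by (intro linked_except_square_arc[of ET _ e f g h]) auto
    qed (use x q e sub parts_disjoint card_incid_p \<open>x \<noteq> y\<close> in \<open>auto simp: minor_def major_def incid_def\<close>)
  next
    case False
    then have q: "even (s q)" using odd by simp
    obtain x x' where x: "x \<in> I q" "x' \<in> I q" "x \<noteq> x'" using two q q_in by blast
    obtain e where e: "e \<in> A" "tail ET e = y" "head ET e = x" using arc rest vw x yz by metis
    obtain f where f: "f \<in> A" "tail ET f = y" "head ET f = x'" using arc rest vw x yz by metis
    obtain g where g: "g \<in> A" "tail ET g = z" "head ET g = x'" using arc rest vw x yz by metis
    obtain h where h: "h \<in> A" "tail ET h = z" "head ET h = x" using arc rest vw x yz by metis
    have "x \<noteq> y" using x yz vw parts_disjoint by blast
    show thesis
    proof (rule that[of x True e])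
      show "linked ET (A - {e}) (tail ET a, True) (head ET a, False)" if "a \<in> A" for a
        using that e f g h x \<open>y \<noteq> z\<close>
        by (intro linked_except_square_arc[of ET _ e f g h]) auto
    qed (use x False e sub parts_disjoint card_incid_q \<open>x \<noteq> y\<close> in \<open>auto simp: minor_def major_def incid_def\<close>)
  qed
qed

text \<open>If both components are even, no vertex switches to color 2. Otherwise the pivot
  switches: this repairs \<open>minor\<close> and changes \<open>major\<close> by
  \<open>sum s R\<close>. If that sum is even, a vertex of an even part in \<open>R\<close> switches
  as well.\<close>

lemma two_coloring:
  assumes "even (s p + s q) \<or> odd (sum s R) \<or> (\<exists>v\<in>R. even (s v))"
  shows "\<exists>\<phi>. weak_odd_edge_coloring ET 2 \<phi>"
proof (cases "even (s p + s q)")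
  case True
  then show ?thesis by (intro two_coloring_of_parities[of "{}"]) auto
next
  case odd: False
  obtain x b where x: "{u. u \<in> minor \<and> fst u = x} = {(x, b)}" "{u. u \<in> major \<and> fst u = x} = {(x, \<not> b)}"
    "x \<in> I p \<union> I q" "odd (card (incid ET A (x, b)))" "card (incid ET A (x, \<not> b)) = sum s R"
    by (rule pivot[OF odd], rule that)
  show ?thesis
  proof (cases "odd (sum s R)")
    case True
    then show ?thesis using x odd by (intro two_coloring_of_parities[of "{x}"]) auto
  next
    case False
    then obtain v where v: "v \<in> R" "even (s v)" using assms odd by auto
    obtain y where y: "y \<in> I v" using part_nonempty v by blast
    have nin: "y \<notin> I p" "y \<notin> I q" "x \<noteq> y" "y \<in> verts ET"
      using y v x(3) parts_disjoint part_subset by blast+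
    have 1: "{u. u \<in> minor \<and> fst u \<in> {x, y}} = {(x, b)}"
    proof -
      have "{u. u \<in> minor \<and> fst u \<in> {x, y}} = {u. u \<in> minor \<and> fst u = x} \<union> {u. u \<in> minor \<and> fst u = y}" by auto
      also have "{u. u \<in> minor \<and> fst u = y} = {}" using nin by (auto simp: minor_def)
      finally show ?thesis using x(1) by simp
    qed
    have 2: "{u. u \<in> major \<and> fst u \<in> {x, y}} = {(x, \<not> b), (y, True), (y, False)}"
    proof -
      have "{u. u \<in> major \<and> fst u \<in> {x, y}} = {u. u \<in> major \<and> fst u = x} \<union> {u. u \<in> major \<and> fst u = y}" by auto
      also have "{u. u \<in> major \<and> fst u = y} = {(y, True), (y, False)}" using nin by (auto simp: major_def)
      finally show ?thesis using x(2) by auto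
    qed
    \<comment> \<open>Here \<open>card (verts ET)\<close> is odd and \<open>s v\<close> is even.
      Both copies of \<open>y\<close> lie in \<open>major\<close>, so its switch repairs
      \<open>major\<close> and leaves \<open>minor\<close> alone.\<close>
    have "odd (card (incid ET A (y, True)) + card (incid ET A (y, False)))"
      using card_incid_total[of v y] v y card_verts_split odd False by (metis DiffD1 even_add)
    then have "even (s p + s q + (\<Sum>u | u \<in> major \<and> fst u \<in> {x, y}. card (incid ET A u)))"
      unfolding 2 using odd nin x(5) False by auto
    moreover have "even (s p + s q + (\<Sum>u | u \<in> minor \<and> fst u \<in> {x, y}. card (incid ET A u)))"
      unfolding 1 using odd x(4) by auto
    ultimately show ?thesis by (intro two_coloring_of_parities[of "{x, y}"])
  qed
qed

text \<open>The pivot repairs \<open>minor\<close> but leaves \<open>major\<close> odd, since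
  \<open>sum s R\<close> is even. Giving \<open>e\<close> color 3 lowers the degree of the
  \<open>major\<close> copy of the pivot by one. The other end of \<open>e\<close> loses an arc too,
  but it lies outside \<open>S\<close>, where \<open>target\<close> ignores
  \<open>E\<close>-degrees.\<close>

lemma three_coloring:
  assumes odd: "odd (s p + s q)" and even: "even (sum s R)"
  shows "\<exists>\<phi>. weak_odd_edge_coloring ET 3 \<phi>"
proof -
  obtain x b e where x: "{u. u \<in> minor \<and> fst u = x} = {(x, b)}" "{u. u \<in> major \<and> fst u = x} = {(x, \<not> b)}"
    "x \<in> I p \<union> I q" "odd (card (incid ET A (x, b)))" "card (incid ET A (x, \<not> b)) = sum s R"
    and e: "e \<in> incid ET A (x, \<not> b)" "e \<notin> incid ET A (x, b)"
    and lk: "\<And>a. a \<in> A \<Longrightarrow> linked ET (A - {e}) (tail ET a, True) (head ET a, False)"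
    by (rule pivot[OF odd], rule that)
  have "incid ET (A - {e}) (x, \<not> b) = incid ET A (x, \<not> b) - {e}" by (auto simp: incid_def)
  then have "Suc (card (incid ET (A - {e}) (x, \<not> b))) = sum s R"
    using card_Suc_Diff1[OF _ e(1)] x(5) by simp
  then have "odd (card (incid ET (A - {e}) (x, \<not> b)))" using even by (metis even_Suc)
  moreover have "incid ET (A - {e}) (x, b) = incid ET A (x, b)" using e(2) by (auto simp: incid_def)
  ultimately show ?thesis using lk x odd
    by (intro coloring_of_parities[of "A - {e}" 3 "{x}"]) auto
qed

text \<open>Count the color-1 arcs of \<open>major\<close> from both sides. The two copies of a
  vertex over \<open>R\<close> contribute equally modulo 2, while each out-copy over
  \<open>I p\<close> and each in-copy over \<open>I q\<close> contributes an odd number; so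
  \<open>s p\<close> and \<open>s q\<close> would agree modulo 2.\<close>

lemma no_two_coloring:
  assumes odd: "odd (s p + s q)" and even: "even (sum s R)" and R: "\<And>v. v \<in> R \<Longrightarrow> odd (s v)"
    and col: "weak_odd_edge_coloring ET k \<phi>" and k: "k \<le> 2"
  shows False
proof -
  define F where "F = {e \<in> A. \<phi> e = 1}"
  let ?d = "\<lambda>x b. card (incid ET A (x, b))" and ?f = "\<lambda>x b. card (incid ET F (x, b))"
  have finF: "finite F" by (auto simp: F_def)
  \<comment> \<open>The first alternative is witness color 1, the second witness color 2, whose
    class consists of the arcs outside \<open>F\<close>.\<close>
  have parity: "(\<forall>b. odd (?f x b)) \<or> (\<forall>b. odd (?d x b + ?f x b))" if x: "x \<in> verts ET" for x
  proof -
    have "weak_odd_at ET k \<phi> x" using col x by (auto simp: weak_odd_edge_coloring_def)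
    then obtain i where i: "i \<in> {1..k}" and
      i': "\<forall>S\<in>{incid ET A (x, True), incid ET A (x, False)}. S \<noteq> {} \<longrightarrow> odd (card {e \<in> S. \<phi> e = i})"
      unfolding weak_odd_at_def out_arcs_incid in_arcs_incid using incid_nonempty[OF x] by blast
    have i2: "odd (card {e \<in> incid ET A (x, b). \<phi> e = i})" for b
      using i' incid_nonempty[OF x, of b] by (cases b) auto
    have F1: "{e \<in> incid ET A (x, b). \<phi> e = 1} = incid ET F (x, b)" for b
      by (auto simp: F_def incid_def)
    show ?thesis
    proof (cases "i = 1")
      case True
      then show ?thesis using i2 F1 by metis
    next
      case False
      then have "i = 2" using i k by auto
      have "odd (?d x b + ?f x b)" for b
      proof -
        have "\<phi> e \<in> {1, 2}" if "e \<in> A" for e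
          using col k that unfolding weak_odd_edge_coloring_def by (fastforce simp: Pi_iff)
        then have "incid ET A (x, b) = {e \<in> incid ET A (x, b). \<phi> e = 2} \<union> incid ET F (x, b)"
          by (auto simp: F_def incid_def)
        moreover have "card ({e \<in> incid ET A (x, b). \<phi> e = 2} \<union> incid ET F (x, b))
            = card {e \<in> incid ET A (x, b). \<phi> e = 2} + ?f x b"
          using finF by (intro card_Un_disjoint) (auto simp: F_def incid_def)
        ultimately have "?d x b = card {e \<in> incid ET A (x, b). \<phi> e = 2} + ?f x b" by simp
        then show ?thesis using i2[of b] \<open>i = 2\<close> by simp
      qed
      then show ?thesis by blast
    qed
  qed
  let ?M = "verts ET - I p - I q"
  have sub: "I p \<subseteq> verts ET" "I q \<subseteq> verts ET" using part_subset p_in q_in by blast+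
  have fin: "finite (I p)" "finite (I q)" using finite_part p_in q_in by auto
  \<comment> \<open>The total degree is even, as \<open>card (verts ET)\<close> and
    \<open>s v\<close> are both odd; hence both alternatives of \<open>parity\<close> give an even
    sum.\<close>
  have fM: "even (?f x True + ?f x False)" if x: "x \<in> ?M" for x
  proof -
    obtain v where v: "v \<in> verts T" "x \<in> I v" using x verts_ET by auto
    then have "odd (s v)" using R x by auto
    then have "even (?d x True + ?d x False)"
      using card_incid_total[OF v] card_verts_split odd even by (metis even_add)
    moreover have "x \<in> verts ET" using x by blast
    ultimately show ?thesis using parity[of x] by (metis even_add)
  qed
  \<comment> \<open>The full degree \<open>sum s R\<close> is even, so both alternatives of
    \<open>parity\<close> make the \<open>F\<close>-degree odd.\<close>
  have fp: "odd (?f x True)" if "x \<in> I p" for x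
    using parity[of x] card_incid_p(1)[OF that] even that sub(1) by (metis even_add subsetD)
  have fq: "odd (?f x False)" if "x \<in> I q" for x
    using parity[of x] card_incid_q(2)[OF that] even that sub(2) by (metis even_add subsetD)
  \<comment> \<open>Since \<open>p\<close> is the only out-neighbour of \<open>q\<close> and
    \<open>q\<close> the only in-neighbour of \<open>p\<close>, tails outside \<open>I q\<close> and
    heads outside \<open>I p\<close> select the same arcs.\<close>
  have cross: "tail ET e \<in> I q \<longleftrightarrow> head ET e \<in> I p" if e: "e \<in> F" for e
  proof -
    have "tail ET e \<rightarrow>\<^bsub>ET\<^esub> head ET e" using e by (auto simp: F_def arcs_ends_def arc_to_ends_def)
    then obtain u v where uv: "u \<in> verts T" "v \<in> verts T" "tail ET e \<in> I u" "head ET e \<in> I v" "u \<rightarrow>\<^bsub>T\<^esub> v"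
      unfolding dominates_ET_iff by blast
    have "v \<in> out_nbrs T u" "u \<in> in_nbrs T v" using uv by (auto simp: out_nbrs_def in_nbrs_def)
    then have "u = q \<longleftrightarrow> v = p" using nbrs by auto
    then show ?thesis using uv part_unique p_in q_in by metis
  qed
  have out: "(\<Sum>x\<in>verts ET - I q. ?f x True) = card {e \<in> F. tail ET e \<notin> I q}"
  proof -
    have "{e \<in> F. tail ET e \<notin> I q} = (\<Union>x\<in>verts ET - I q. incid ET F (x, True))"
      by (auto simp: incid_def F_def)
    then show ?thesis using finF by (simp, subst card_UN_disjoint) (auto simp: incid_def)
  qed
  have inn: "(\<Sum>x\<in>verts ET - I p. ?f x False) = card {e \<in> F. head ET e \<notin> I p}"
  proof -
    have "{e \<in> F. head ET e \<notin> I p} = (\<Union>x\<in>verts ET - I p. incid ET F (x, False))"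
      by (auto simp: incid_def F_def)
    then show ?thesis using finF by (simp, subst card_UN_disjoint) (auto simp: incid_def)
  qed
  have "{e \<in> F. tail ET e \<notin> I q} = {e \<in> F. head ET e \<notin> I p}" using cross by auto
  then have eq: "(\<Sum>x\<in>verts ET - I q. ?f x True) = (\<Sum>x\<in>verts ET - I p. ?f x False)"
    using out inn by simp
  have "verts ET - I q = I p \<union> ?M" "verts ET - I p = I q \<union> ?M" "I p \<inter> ?M = {}" "I q \<inter> ?M = {}"
    using sub parts_disjoint by blast+
  moreover have "finite ?M" by simp
  ultimately have eq': "(\<Sum>x\<in>I p. ?f x True) + (\<Sum>x\<in>?M. ?f x True) = (\<Sum>x\<in>I q. ?f x False) + (\<Sum>x\<in>?M. ?f x False)"
    using eq fin by (metis (no_types, lifting) sum.union_disjoint)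
  have "even (\<Sum>x\<in>?M. ?f x True + ?f x False)" using fM by (intro dvd_sum) auto
  then have M: "even ((\<Sum>x\<in>?M. ?f x True) + (\<Sum>x\<in>?M. ?f x False))" by (simp add: sum.distrib)
  have "{x \<in> I p. odd (?f x True)} = I p" "{x \<in> I q. odd (?f x False)} = I q" using fp fq by blast+
  then have "even (\<Sum>x\<in>I p. ?f x True) \<longleftrightarrow> even (s p)" "even (\<Sum>x\<in>I q. ?f x False) \<longleftrightarrow> even (s q)"
    unfolding even_sum_iff[OF fin(1)] even_sum_iff[OF fin(2)]
    by (simp_all only: card_part[OF p_in] card_part[OF q_in])
  then show False using eq' M odd by (metis even_add)
qed

end

section \<open>Badness in terms of the cyclic pair\<close>

context extended_tournament
begin

text \<open>The even vertex \<open>j\<close> plays the role of \<open>p\<close> if it has a single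
  in-neighbour, which is then \<open>q\<close>; otherwise it is \<open>q\<close> and its single
  out-neighbour is \<open>p\<close>. The domination condition supplies \<open>rest\<close>.\<close>

lemma bad_extension_cyclic:
  assumes bad: "bad_extension T s ET"
  obtains p q where "cyclic_extension T s I ET p q" "odd (s p + s q)"
    "even (sum s (verts T - {p, q}))" "\<And>v. v \<in> verts T - {p, q} \<Longrightarrow> odd (s v)"
proof -
  obtain j where j: "{v \<in> verts T. even (s v)} = {j}"
    and dom: "\<And>x y. x \<in> out_nbrs T j \<Longrightarrow> y \<in> in_nbrs T j \<Longrightarrow> x \<rightarrow>\<^bsub>T\<^esub> y"
    and one: "card (in_nbrs T j) = 1 \<or> card (out_nbrs T j) = 1"
    and gt3: "card (verts T) > 3" and N: "odd (card (verts ET))"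
    using bad unfolding bad_extension_def by blast
  have jV: "j \<in> verts T" and ev: "\<And>v. v \<in> verts T \<Longrightarrow> even (s v) \<longleftrightarrow> v = j" using j by blast+
  have nb: "v \<in> out_nbrs T j \<or> v \<in> in_nbrs T j" if "v \<in> verts T" "v \<noteq> j" for v
    using that exactly_one_arc jV unfolding out_nbrs_def in_nbrs_def by blast
  have nj: "j \<notin> out_nbrs T j" "j \<notin> in_nbrs T j"
    using adj_not_same unfolding out_nbrs_def in_nbrs_def by blast+
  obtain p q where pq: "cyclic_extension T s I ET p q" "j = p \<or> j = q"
  proof (cases "card (in_nbrs T j) = 1")
    case True
    then obtain q where q: "in_nbrs T j = {q}" by (auto simp: card_1_singleton_iff)
    have "cyclic_extension T s I ET j q"
    proof unfold_locales
      show "j \<rightarrow>\<^bsub>T\<^esub> v \<and> v \<rightarrow>\<^bsub>T\<^esub> q" if "v \<in> verts T - {j, q}" for v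
      proof -
        have "v \<in> out_nbrs T j" using that nb[of v] q by blast
        then show ?thesis using dom[of v q] q by (simp add: out_nbrs_def)
      qed
    qed (use jV q nj gt3 in \<open>auto simp: in_nbrs_def\<close>)
    then show thesis using that by blast
  next
    case False
    then obtain p where p: "out_nbrs T j = {p}" using one by (auto simp: card_1_singleton_iff)
    have "cyclic_extension T s I ET p j"
    proof unfold_locales
      show "p \<rightarrow>\<^bsub>T\<^esub> v \<and> v \<rightarrow>\<^bsub>T\<^esub> j" if "v \<in> verts T - {p, j}" for v
      proof -
        have "v \<in> in_nbrs T j" using that nb[of v] p by blast
        then show ?thesis using dom[of p v] p by (simp add: in_nbrs_def)
      qed
    qed (use jV p nj gt3 in \<open>auto simp: out_nbrs_def\<close>)
    then show thesis using that by blast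
  qed
  interpret cyclic_extension T s I ET p q by (fact pq(1))
  have odd: "odd (s p + s q)" using ev[OF p_in] ev[OF q_in] pq(2) p_neq_q by auto
  show thesis
  proof (rule that[OF pq(1) odd])
    show "even (sum s R)" using N odd card_verts_split by simp
    show "odd (s v)" if "v \<in> R" for v using that ev pq(2) by blast
  qed
qed

text \<open>If all alternatives of \<open>two_coloring\<close> fail for a cyclic pair, the one of
  \<open>p\<close>, \<open>q\<close> with even part is a vertex \<open>j\<close> that makes
  \<open>ET\<close> bad.\<close>

lemma two_coloring_if_not_bad:
  assumes "card (verts T) > 3" "\<exists>v\<in>verts T. even (s v)" "\<not> bad_extension T s ET"
  shows "\<exists>\<phi>. weak_odd_edge_coloring ET 2 \<phi>"
  using linked_or_cyclic_pair
proof
  assume "\<forall>u w. incid ET (arcs ET) u \<noteq> {} \<longrightarrow> incid ET (arcs ET) w \<noteq> {} \<longrightarrow> linked ET (arcs ET) u w"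
  then show ?thesis using two_coloring_if_linked assms(2) by blast
next
  assume "\<exists>p q. p \<in> verts T \<and> q \<in> verts T \<and> p \<noteq> q \<and> q \<rightarrow>\<^bsub>T\<^esub> p \<and>
       (\<forall>x\<in>verts T - {p, q}. p \<rightarrow>\<^bsub>T\<^esub> x \<and> x \<rightarrow>\<^bsub>T\<^esub> q)"
  then obtain p q where pq: "p \<in> verts T" "q \<in> verts T" "p \<noteq> q" "q \<rightarrow>\<^bsub>T\<^esub> p"
    "\<And>x. x \<in> verts T - {p, q} \<Longrightarrow> p \<rightarrow>\<^bsub>T\<^esub> x \<and> x \<rightarrow>\<^bsub>T\<^esub> q" by blast
  interpret cyclic_extension T s I ET p q
    by unfold_locales (use pq assms(1) in auto)
  show ?thesis
  proof (rule two_coloring, rule ccontr)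
    assume "\<not> (even (s p + s q) \<or> odd (sum s R) \<or> (\<exists>v\<in>R. even (s v)))"
    then have *: "odd (s p + s q)" "even (sum s R)" "\<And>v. v \<in> R \<Longrightarrow> odd (s v)" by blast+
    define j where "j = (if even (s p) then p else q)"
    have jpq: "j = p \<or> j = q" by (simp add: j_def)
    have "even (s v) \<longleftrightarrow> v = j" if "v \<in> verts T" for v
      using that *(1) *(3)[of v] p_neq_q by (cases "v = p"; cases "v = q") (auto simp: j_def)
    then have "{v \<in> verts T. even (s v)} = {j}" using jpq p_in q_in by blast
    moreover have "x \<rightarrow>\<^bsub>T\<^esub> y" if "x \<in> out_nbrs T j" "y \<in> in_nbrs T j" for x y
      using jpq that rest by (auto simp: nbrs)
    moreover have "card (in_nbrs T j) = 1 \<or> card (out_nbrs T j) = 1"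
      using jpq by (auto simp: nbrs)
    moreover have "odd (card (verts ET))" using * card_verts_split by simp
    ultimately have "bad_extension T s ET" unfolding bad_extension_def using assms(1) by blast
    then show False using assms(3) by contradiction
  qed
qed

end

theorem theorem4p4:
  fixes T :: "('a, 'b) pre_digraph" and s :: "'a \<Rightarrow> nat"
    and I :: "'a \<Rightarrow> 'c set" and ET :: "('c, 'd) pre_digraph"
  assumes "extended_tournament T s I ET"
    and "card (verts T) > 3"
    and "\<exists>v\<in>verts T. even (s v)"
  shows "(bad_extension T s ET \<longrightarrow> weak_odd_chromatic_index ET = 3) \<and>
         (\<not> bad_extension T s ET \<longrightarrow> weak_odd_chromatic_index ET \<le> 2)"
proof (intro conjI impI)
  interpret extended_tournament T s I ET by (fact assms(1))
  assume bad: "bad_extension T s ET"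
  obtain p q where pq: "cyclic_extension T s I ET p q" "odd (s p + s q)"
    "even (sum s (verts T - {p, q}))" "\<And>v. v \<in> verts T - {p, q} \<Longrightarrow> odd (s v)"
    by (rule bad_extension_cyclic[OF bad], rule that)
  interpret cyclic_extension T s I ET p q by (fact pq(1))
  have "weak_odd_chromatic_index ET \<le> enat 3"
    unfolding weak_odd_chromatic_index_def using three_coloring[OF pq(2,3)] by (intro Inf_lower) blast
  \<comment> \<open>The values 0, 1 and 2 of \<open>k\<close> are excluded at once by
    \<open>no_two_coloring\<close>, so 3 bounds the whole set from below.\<close>
  moreover have "enat 3 \<le> weak_odd_chromatic_index ET"
    unfolding weak_odd_chromatic_index_def
  proof (rule Inf_greatest)
    fix n assume "n \<in> {enat k |k. \<exists>\<phi>. weak_odd_edge_coloring ET k \<phi>}"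
    then obtain k \<phi> where k: "n = enat k" "weak_odd_edge_coloring ET k \<phi>" by blast
    then have "\<not> k \<le> 2" using no_two_coloring[OF pq(2-4)] by blast
    then show "enat 3 \<le> n" using k(1) by simp
  qed
  ultimately show "weak_odd_chromatic_index ET = 3" by (simp add: numeral_eq_enat)
next
  interpret extended_tournament T s I ET by (fact assms(1))
  assume "\<not> bad_extension T s ET"
  then have "\<exists>\<phi>. weak_odd_edge_coloring ET 2 \<phi>" using two_coloring_if_not_bad assms(2,3) by blast
  then have "weak_odd_chromatic_index ET \<le> enat 2"
    unfolding weak_odd_chromatic_index_def by (intro Inf_lower) blast
  then show "weak_odd_chromatic_index ET \<le> 2" by (simp add: numeral_eq_enat)
qed

end
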